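(* For any property $\mathcal{P}$ (a set of finite graphs), the following are equivalent: (A) $\mathcal{P}$ is hereditary compositive; (B) $\mathcal{P}$ has a $\subseteq$-generating set, and moreover, for any graph $L\in\mathcal{P}$ and any $\subseteq$-generating set $\mathcal{G}$ of $\mathcal{P}$, the set $\mathcal{G}[L]_{\subseteq}$ is also a $\subseteq$-generating set; (C) $\mathcal{P}$ has an ordered $\subseteq$-generating set $G_1\subseteq G_2\subseteq\cdots$; (D) $\mathcal{P}$ has an ordered $\subseteq$-generating set $H_1<H_2<\cdots$ in which each $H_i$ is $\mathcal{P}$-maximal; (E) $\mathcal{P}$ has a $\subseteq$-generating graph $H$.
   Context: Graphs in properties are finite, simple and unlabelled; a $\subseteq$-generating graph may be infinite. $G\subseteq H$ means $G$ is (isomorphic to) a subgraph of $H$, and $G<H$ means $G$ is a proper induced subgraph of $H$. A property is hereditary if it is closed under subgraphs; it is hereditary compositive if it is hereditary and for any $G,H\in\mathcal{P}$ there is a graph in $\mathcal{P}$ containing both $G$ and $H$ as subgraphs. A $\subseteq$-generating set for $\mathcal{P}$ is a set $\mathcal{G}\subseteq\mathcal{P}$ such that every graph in $\mathcal{P}$ is a subgraph of some member of $\mathcal{G}$; it is ordered if its elements can be listed as $G_1\subseteq G_2\subseteq\cdots$. For a set $\mathcal{G}$ and a graph $L$, $\mathcal{G}[L]_{\subseteq}=\{G\in\mathcal{G}\mid L\subseteq G\}$. A graph $H$ is a $\subseteq$-generating graph for $\mathcal{P}$ if $\mathcal{P}=\{G\mid G\subseteq H,\ |V(G)|\text{ finite}\}$.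 A graph $G$ is $\mathcal{P}$-maximal if $G\in\mathcal{P}$ but $G+e\notin\mathcal{P}$ for every edge $e$ joining two nonadjacent vertices of $G$.
   Formalization: A generating set is required to generate exactly P (P is the set of all subgraphs of its members), since otherwise P={K_2} satisfies (B)-(D) but not (A); P is assumed nonempty, since the empty property satisfies (A) but not (E); ordered lists may be finite. *)

theory Defs
  imports Main "HOL-Library.Extended_Nat" "HOL-Library.Infinite_Typeclass"
begin

datatype 'a sgraph = SGraph (verts: "'a set") (edges: "'a set set")

text \<open>The vertex set may be empty or infinite.\<close>

definition simple_graph :: "'a sgraph \<Rightarrow> bool" where
  "simple_graph G \<longleftrightarrow> (\<forall>e\<in>edges G. \<exists>u\<in>verts G. \<exists>v\<in>verts G. u \<noteq> v \<and> e = {u, v})"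

definition finite_graph :: "'a sgraph \<Rightarrow> bool" where
  "finite_graph G \<longleftrightarrow> simple_graph G \<and> finite (verts G)"

definition graph_iso :: "'a sgraph \<Rightarrow> 'b sgraph \<Rightarrow> bool" where
  "graph_iso G H \<longleftrightarrow> simple_graph G \<and> simple_graph H \<and>
     (\<exists>f. bij_betw f (verts G) (verts H) \<and>
       (\<forall>u\<in>verts G. \<forall>v\<in>verts G. {u, v} \<in> edges G \<longleftrightarrow> {f u, f v} \<in> edges H))"

definition is_subgraph :: "'a sgraph \<Rightarrow> 'a sgraph \<Rightarrow> bool" where
  "is_subgraph K H \<longleftrightarrow> simple_graph K \<and> verts K \<subseteq> verts H \<and> edges K \<subseteq> edges H"

definition induced :: "'a sgraph \<Rightarrow> 'a set \<Rightarrow> 'a sgraph" where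
  "induced H W = SGraph W {e \<in> edges H. e \<subseteq> W}"

text \<open>
  Graphs are unlabelled, so the two containment relations are taken up to isomorphism;
  the two graphs may live on different vertex types.
\<close>

definition sub :: "'a sgraph \<Rightarrow> 'b sgraph \<Rightarrow> bool" (infix "\<sqsubseteq>" 50) where
  "G \<sqsubseteq> H \<longleftrightarrow> (\<exists>K. is_subgraph K H \<and> graph_iso G K)"

definition proper_induced_sub :: "'a sgraph \<Rightarrow> 'b sgraph \<Rightarrow> bool" (infix "\<sqsubset>\<^sub>i" 50) where
  "G \<sqsubset>\<^sub>i H \<longleftrightarrow> (\<exists>W. W \<subset> verts H \<and> graph_iso G (induced H W))"

text \<open>
  A set of finite unlabelled graphs is represented by an isomorphism-closed set of finite
  graphs with vertices in \<^typ>\<open>nat\<close>. As is usual for graph properties, the empty set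
  is excluded: it is vacuously hereditary and compositive, but it has no generating graph,
  because the null graph is a subgraph of every graph.
\<close>

definition graph_property :: "nat sgraph set \<Rightarrow> bool" where
  "graph_property P \<longleftrightarrow> P \<noteq> {} \<and> (\<forall>G\<in>P. finite_graph G) \<and>
     (\<forall>G\<in>P. \<forall>H. graph_iso G H \<longrightarrow> H \<in> P)"

definition hereditary :: "nat sgraph set \<Rightarrow> bool" where
  "hereditary P \<longleftrightarrow> (\<forall>G\<in>P. \<forall>H. H \<sqsubseteq> G \<longrightarrow> H \<in> P)"

definition hereditary_compositive :: "nat sgraph set \<Rightarrow> bool" where
  "hereditary_compositive P \<longleftrightarrow> hereditary P \<and> (\<forall>G\<in>P. \<forall>H\<in>P. \<exists>K\<in>P. G \<sqsubseteq> K \<and> H \<sqsubseteq> K)"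

text \<open>
  A generating set generates \<open>P\<close> and nothing else: \<open>P\<close> consists of exactly the
  subgraphs of its members. If only the inclusion of \<open>P\<close> in the set of these subgraphs
  were required, every \<open>P\<close> would be a generating set of itself, and a property such as
  the isomorphism class of a single edge would have an ordered generating set without being
  hereditary. For hereditary \<open>P\<close> the two versions agree.
\<close>

definition generating_set :: "nat sgraph set \<Rightarrow> nat sgraph set \<Rightarrow> bool" where
  "generating_set P \<G> \<longleftrightarrow> \<G> \<subseteq> P \<and> P = {G. \<exists>H\<in>\<G>. G \<sqsubseteq> H}"

definition members_above :: "nat sgraph set \<Rightarrow> nat sgraph \<Rightarrow> nat sgraph set" where
  "members_above \<G> L = {G \<in> \<G>. L \<sqsubseteq> G}"

text \<open>
  The elements of \<open>S\<close> form a finite or infinite list in which consecutive elements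
  are related by \<open>R\<close>; \<open>N\<close> is the length of the list.
\<close>

definition listed_by :: "('g \<Rightarrow> 'g \<Rightarrow> bool) \<Rightarrow> 'g set \<Rightarrow> bool" where
  "listed_by R S \<longleftrightarrow> (\<exists>(N::enat) g. S = g ` {i. enat i < N} \<and>
     (\<forall>i. enat (Suc i) < N \<longrightarrow> R (g i) (g (Suc i))))"

text \<open>
  The vertex type is arbitrary, so that generating graphs of every cardinality are covered.
  An existence statement about generating graphs needs an infinite vertex type.
\<close>

definition generating_graph :: "nat sgraph set \<Rightarrow> 'v sgraph \<Rightarrow> bool" where
  "generating_graph P H \<longleftrightarrow> simple_graph H \<and> P = {G. finite_graph G \<and> G \<sqsubseteq> H}"

definition add_edge :: "'a sgraph \<Rightarrow> 'a \<Rightarrow> 'a \<Rightarrow> 'a sgraph" where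
  "add_edge G u v = SGraph (verts G) (insert {u, v} (edges G))"

definition maximal_in :: "nat sgraph set \<Rightarrow> nat sgraph \<Rightarrow> bool" where
  "maximal_in P G \<longleftrightarrow> G \<in> P \<and>
     (\<forall>u\<in>verts G. \<forall>v\<in>verts G. u \<noteq> v \<and> {u, v} \<notin> edges G \<longrightarrow> add_edge G u v \<notin> P)"

end

theory Submission
  imports Defs "HOL-Library.Countable_Set"
begin

text \<open>
  A hereditary compositive property is countable, so enumerating it and composing step by step
  gives an ordered generating set. Relabelling makes every graph of the list a genuine subgraph of
  the next one, and the union of the list is then a generating graph: a finite subgraph of the
  union already lies in some member. For the list of maximal graphs, the point is that a maximal
  graph contained in a member of the property is automatically an induced subgraph of it, since a
  missing edge could be added to it within the property. So it suffices to saturate with edges after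
  each composition; if the orders of the graphs are bounded, a single graph of largest size does.
\<close>

section \<open>Relabelling, isomorphism and embeddings of graphs\<close>

definition map_graph :: "('a \<Rightarrow> 'b) \<Rightarrow> 'a sgraph \<Rightarrow> 'b sgraph" where
  "map_graph f G = SGraph (f ` verts G) ((`) f ` edges G)"

lemma verts_map_graph [simp]: "verts (map_graph f G) = f ` verts G"
  and edges_map_graph [simp]: "edges (map_graph f G) = (`) f ` edges G"
  by (simp_all add: map_graph_def)

lemma simple_graph_edge_subset:
  "simple_graph G \<Longrightarrow> e \<in> edges G \<Longrightarrow> e \<subseteq> verts G"
  by (auto simp: simple_graph_def)

lemma simple_graph_edgeE:
  assumes "simple_graph G" "e \<in> edges G"
  obtains u v where "u \<in> verts G" "v \<in> verts G" "u \<noteq> v" "e = {u, v}"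
  using assms unfolding simple_graph_def by blast

lemma finite_edges: "finite_graph G \<Longrightarrow> finite (edges G)"
  by (rule finite_subset[of _ "Pow (verts G)"])
    (auto simp: finite_graph_def dest: simple_graph_edge_subset)

text \<open>Injectivity on the vertices does two jobs: it keeps the ends of every edge distinct, so
  that no loop arises, and it lets an edge of the image be traced back to a single edge of
  \<open>G\<close>.\<close>

lemma graph_iso_map_graph:
  assumes "simple_graph G" "inj_on f (verts G)"
  shows "graph_iso G (map_graph f G)"
proof -
  have "simple_graph (map_graph f G)"
    unfolding simple_graph_def
  proof
    fix e assume "e \<in> edges (map_graph f G)"
    then obtain d where d: "d \<in> edges G" "e = f ` d" by auto
    obtain u v where uv: "u \<in> verts G" "v \<in> verts G" "u \<noteq> v" "d = {u, v}"
      using simple_graph_edgeE[OF assms(1) d(1)] .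
    then have "f u \<noteq> f v" using assms(2) by (auto dest: inj_onD)
    with uv d(2)
    show "\<exists>u\<in>verts (map_graph f G). \<exists>v\<in>verts (map_graph f G). u \<noteq> v \<and> e = {u, v}"
      by (intro bexI[of _ "f u"] bexI[of _ "f v"]) auto
  qed
  moreover have "{u, v} \<in> edges G \<longleftrightarrow> {f u, f v} \<in> edges (map_graph f G)"
    if "u \<in> verts G" "v \<in> verts G" for u v
  proof
    assume "{u, v} \<in> edges G"
    then show "{f u, f v} \<in> edges (map_graph f G)"
      by (auto intro!: image_eqI[where x = "{u, v}"])
  next
    assume "{f u, f v} \<in> edges (map_graph f G)"
    then obtain d where d: "d \<in> edges G" "f ` {u, v} = f ` d" by auto
    then have "{u, v} = d"
      using inj_on_image_eq_iff[OF assms(2), of "{u, v}" d] that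
        simple_graph_edge_subset[OF assms(1) d(1)] by auto
    with d(1) show "{u, v} \<in> edges G" by simp
  qed
  ultimately show ?thesis
    unfolding graph_iso_def using assms
    by (auto simp: bij_betw_def intro!: exI[of _ f])
qed

lemma graph_iso_sym:
  assumes "graph_iso G H" shows "graph_iso H G"
proof -
  obtain f where G: "simple_graph G" and H: "simple_graph H"
    and f: "bij_betw f (verts G) (verts H)"
    and e: "\<And>u v. u \<in> verts G \<Longrightarrow> v \<in> verts G \<Longrightarrow> {u, v} \<in> edges G \<longleftrightarrow> {f u, f v} \<in> edges H"
    using assms unfolding graph_iso_def by blast
  define g where "g = inv_into (verts G) f"
  have g: "bij_betw g (verts H) (verts G)"
    unfolding g_def by (rule bij_betw_inv_into[OF f])
  have gV: "g u \<in> verts G" and fg: "f (g u) = u" if "u \<in> verts H" for u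
    using that g bij_betw_inv_into_right[OF f] by (auto simp: g_def bij_betw_def)
  have "{u, v} \<in> edges H \<longleftrightarrow> {g u, g v} \<in> edges G" if "u \<in> verts H" "v \<in> verts H" for u v
    using e[OF gV gV, OF that] fg that by simp
  with g G H show ?thesis unfolding graph_iso_def by blast
qed

text \<open>The copy of \<open>G\<close> in \<open>H\<close> is its image under \<open>f\<close>,
  which need not be an induced subgraph; so \<open>f\<close> has to preserve edges but not to
  reflect them. Most later arguments work with such maps instead of isomorphic copies.\<close>

lemma sub_iff_embedding:
  "G \<sqsubseteq> H \<longleftrightarrow> simple_graph G \<and>
    (\<exists>f. inj_on f (verts G) \<and> f ` verts G \<subseteq> verts H \<and> (\<forall>e\<in>edges G. f ` e \<in> edges H))"
  (is "_ \<longleftrightarrow> _ \<and> (\<exists>f. ?emb f)")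
proof
  assume "G \<sqsubseteq> H"
  then obtain K f where K: "is_subgraph K H" and G: "simple_graph G"
    and f: "bij_betw f (verts G) (verts K)"
    and e: "\<And>u v. u \<in> verts G \<Longrightarrow> v \<in> verts G \<Longrightarrow> {u, v} \<in> edges G \<longleftrightarrow> {f u, f v} \<in> edges K"
    unfolding sub_def graph_iso_def by blast
  have "f ` d \<in> edges H" if d: "d \<in> edges G" for d
  proof -
    obtain u v where uv: "u \<in> verts G" "v \<in> verts G" "d = {u, v}"
      using simple_graph_edgeE[OF G d] .
    then have "f ` d \<in> edges K" using e d by simp
    with K show ?thesis by (auto simp: is_subgraph_def)
  qed
  moreover have "inj_on f (verts G)" "f ` verts G \<subseteq> verts H"
    using f K by (auto simp: bij_betw_def is_subgraph_def)
  ultimately show "simple_graph G \<and> (\<exists>f. ?emb f)" using G by blast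
next
  assume "simple_graph G \<and> (\<exists>f. ?emb f)"
  then obtain f where G: "simple_graph G" and f: "?emb f" by blast
  have iso: "graph_iso G (map_graph f G)" using G f by (blast intro: graph_iso_map_graph)
  then have "is_subgraph (map_graph f G) H"
    using f by (auto simp: is_subgraph_def graph_iso_def)
  with iso show "G \<sqsubseteq> H" unfolding sub_def by blast
qed

lemma subE:
  assumes "G \<sqsubseteq> H"
  obtains f where "inj_on f (verts G)" "f ` verts G \<subseteq> verts H" "\<And>e. e \<in> edges G \<Longrightarrow> f ` e \<in> edges H"
  using assms unfolding sub_iff_embedding by blast

lemma subI:
  assumes "simple_graph G" "inj_on f (verts G)" "f ` verts G \<subseteq> verts H"
    "\<And>e. e \<in> edges G \<Longrightarrow> f ` e \<in> edges H"
  shows "G \<sqsubseteq> H"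
  using assms unfolding sub_iff_embedding by blast

lemma sub_imp_simple: "G \<sqsubseteq> H \<Longrightarrow> simple_graph G"
  by (simp add: sub_iff_embedding)

lemma is_subgraph_imp_sub: "is_subgraph G H \<Longrightarrow> G \<sqsubseteq> H"
  by (rule subI[where f = "\<lambda>x. x"]) (auto simp: is_subgraph_def)

lemma sub_refl: "simple_graph G \<Longrightarrow> G \<sqsubseteq> G"
  by (rule is_subgraph_imp_sub) (simp add: is_subgraph_def)

lemma sub_trans [trans]:
  assumes "G \<sqsubseteq> H" "H \<sqsubseteq> K" shows "G \<sqsubseteq> K"
proof -
  obtain f where f: "inj_on f (verts G)" "f ` verts G \<subseteq> verts H"
    "\<And>e. e \<in> edges G \<Longrightarrow> f ` e \<in> edges H"
    using subE[OF assms(1)] by blast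
  obtain g where g: "inj_on g (verts H)" "g ` verts H \<subseteq> verts K"
    "\<And>e. e \<in> edges H \<Longrightarrow> g ` e \<in> edges K"
    using subE[OF assms(2)] by blast
  show ?thesis
  proof (rule subI[where f = "g \<circ> f"])
    show "inj_on (g \<circ> f) (verts G)"
      using f g by (blast intro: comp_inj_on inj_on_subset)
    show "(g \<circ> f) ` verts G \<subseteq> verts K"
      using f(2) g(2) by fastforce
    show "(g \<circ> f) ` e \<in> edges K" if "e \<in> edges G" for e
      using g(3)[OF f(3)[OF that]] by (simp add: image_comp)
  qed (rule sub_imp_simple[OF assms(1)])
qed

lemma graph_iso_imp_sub: "graph_iso G H \<Longrightarrow> G \<sqsubseteq> H"
  unfolding sub_def by (rule exI[of _ H]) (auto simp: is_subgraph_def graph_iso_def)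

lemma proper_induced_sub_imp_sub:
  assumes "G \<sqsubset>\<^sub>i H" shows "G \<sqsubseteq> H"
proof -
  obtain W where "W \<subset> verts H" "graph_iso G (induced H W)"
    using assms unfolding proper_induced_sub_def by blast
  then show ?thesis
    unfolding sub_def
    by (intro exI[of _ "induced H W"]) (auto simp: is_subgraph_def induced_def graph_iso_def)
qed

lemma sub_finite:
  assumes "G \<sqsubseteq> H" "finite_graph H"
  shows "finite_graph G"
proof -
  obtain f where "inj_on f (verts G)" "f ` verts G \<subseteq> verts H"
    using subE[OF assms(1)] by metis
  then have "finite (verts G)"
    using assms(2) unfolding finite_graph_def by (meson finite_subset finite_image_iff)
  with sub_imp_simple[OF assms(1)] show ?thesis by (simp add: finite_graph_def)
qed

lemma sub_card_verts_le:
  assumes "G \<sqsubseteq> H" "finite_graph H"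
  shows "card (verts G) \<le> card (verts H)"
  using assms by (auto elim!: subE simp: finite_graph_def intro: card_inj_on_le)

text \<open>An embedding of \<open>G\<close> in \<open>H\<close> injects vertices into vertices and
  edges into edges. Each count is thus at most that of \<open>H\<close>, so the bound on the sums
  forces both to agree; by finiteness both injections are onto, and the image of \<open>G\<close> is
  \<open>H\<close> itself.\<close>

lemma sub_antisym_size:
  assumes sub: "G \<sqsubseteq> H" and H: "finite_graph H"
    and size: "card (verts H) + card (edges H) \<le> card (verts G) + card (edges G)"
  shows "H \<sqsubseteq> G"
proof -
  obtain f where f: "inj_on f (verts G)" "f ` verts G \<subseteq> verts H"
    "\<And>e. e \<in> edges G \<Longrightarrow> f ` e \<in> edges H"
    using subE[OF sub] by blast
  have G: "simple_graph G" by (rule sub_imp_simple[OF sub])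
  have fin: "finite (verts H)" "finite (edges H)"
    using H finite_edges by (auto simp: finite_graph_def)
  \<comment> \<open>A map injective on a set acts injectively on its subsets, and edges are subsets
    of the vertex set.\<close>
  have injE: "inj_on ((`) f) (edges G)"
    by (rule inj_on_subset[OF inj_on_image_Pow[OF f(1)]])
      (use simple_graph_edge_subset[OF G] in auto)
  have "card (f ` verts G) \<le> card (verts H)" "card ((`) f ` edges G) \<le> card (edges H)"
    using f fin by (auto intro!: card_mono)
  moreover have "card (f ` verts G) = card (verts G)" "card ((`) f ` edges G) = card (edges G)"
    using f(1) injE by (simp_all add: card_image)
  ultimately have "card (f ` verts G) = card (verts H)" "card ((`) f ` edges G) = card (edges H)"
    using size by linarith+
  then have "f ` verts G = verts H" "(`) f ` edges G = edges H"
    using f fin by (intro card_subset_eq; blast)+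
  then have "map_graph f G = H"
    by (simp add: map_graph_def)
  with graph_iso_map_graph[OF G f(1)] show ?thesis
    by (auto intro: graph_iso_imp_sub graph_iso_sym)
qed

section \<open>Countability of the finite graphs, and containment made literal\<close>

lemma countable_finite_graphs: "countable {G :: nat sgraph. finite_graph G}"
proof (rule countable_image_inj_on)
  \<comment> \<open>A graph is determined by its vertex set and its edge set. For a finite graph the
    first is a finite set of naturals and the second a finite set of such sets, which leaves
    countably many pairs.\<close>
  let ?S = "{V :: nat set. finite V} \<times> {E :: nat set set. finite E \<and> E \<subseteq> {V. finite V}}"
  have "countable ?S"
    by (intro countable_SIGMA countable_Collect_finite countable_Collect_finite_subset)
  moreover have "(\<lambda>G. (verts G, edges G)) ` {G :: nat sgraph. finite_graph G} \<subseteq> ?S"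
    by (auto simp: finite_edges) (auto simp: finite_graph_def dest: simple_graph_edge_subset finite_subset)
  ultimately show "countable ((\<lambda>G. (verts G, edges G)) ` {G :: nat sgraph. finite_graph G})"
    by (rule countable_subset[rotated])
  show "inj_on (\<lambda>G. (verts G, edges G)) {G :: nat sgraph. finite_graph G}"
    by (auto simp: inj_on_def intro: sgraph.expand)
qed

text \<open>The larger graph is relabelled and \<open>K\<close> is left alone, so that a chain of
  containments can be turned into a chain of literal inclusions step by step, without disturbing the
  graphs already chosen.\<close>

lemma graph_iso_extending_subgraph:
  fixes K G :: "nat sgraph"
  assumes "K \<sqsubseteq> G" "finite_graph G"
  obtains G' where "graph_iso G G'" "is_subgraph K G'"
proof -
  obtain f where f: "inj_on f (verts K)" "f ` verts K \<subseteq> verts G"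
    "\<And>e. e \<in> edges K \<Longrightarrow> f ` e \<in> edges G"
    using subE[OF assms(1)] by blast
  have K: "finite_graph K" by (rule sub_finite[OF assms])
  define W where "W = f ` verts K"
  \<comment> \<open>Undo \<open>f\<close> on its image and shift the remaining vertices of \<open>G\<close> beyond those of \<open>K\<close>.\<close>
  define h where "h x = (if x \<in> W then inv_into (verts K) f x else Suc (Max (insert 0 (verts K))) + x)" for x
  have le: "x \<le> Max (insert 0 (verts K))" if "x \<in> verts K" for x
    using K that by (simp add: finite_graph_def)
  have hf: "h (f x) = x" if "x \<in> verts K" for x
    using that f(1) by (simp add: h_def W_def)
  have hW: "h x \<le> Max (insert 0 (verts K))" if "x \<in> W" for x
    using that le hf by (auto simp: W_def)
  have hnW: "h x = Suc (Max (insert 0 (verts K))) + x" if "x \<notin> W" for x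
    using that by (simp add: h_def)
  \<comment> \<open>On \<open>W\<close> the map inverts \<open>f\<close>, outside \<open>W\<close>
    it is a shift. The mixed cases cannot occur, because \<open>W\<close> is sent to values at most
    the maximum and every other vertex above it.\<close>
  have inj: "inj_on h (verts G)"
  proof (rule inj_onI)
    fix x y assume eq: "h x = h y"
    consider "x \<in> W" "y \<in> W" | "x \<notin> W" "y \<notin> W" | "x \<in> W" "y \<notin> W" | "x \<notin> W" "y \<in> W" by blast
    then show "x = y"
    proof cases
      case 1 then show ?thesis using eq hf by (auto simp: W_def)
    next
      case 2 then show ?thesis using eq hnW by simp
    next
      case 3 then show ?thesis using eq hW[of x] hnW[of y] by simp
    next
      case 4 then show ?thesis using eq hW[of y] hnW[of x] by simp
    qed
  qed
  have "x \<in> h ` verts G" if "x \<in> verts K" for x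
    by (rule image_eqI[of _ _ "f x"]) (use f(2) that hf in auto)
  moreover have "e \<in> (`) h ` edges G" if e: "e \<in> edges K" for e
  proof -
    have "e \<subseteq> verts K" using K e by (auto simp: finite_graph_def dest: simple_graph_edge_subset)
    then have "h ` (f ` e) = id ` e"
      unfolding image_image by (intro image_cong) (auto simp: hf)
    with f(3)[OF e] show ?thesis by (auto intro!: image_eqI[of _ _ "f ` e"])
  qed
  ultimately have "is_subgraph K (map_graph h G)"
    using K by (auto simp: is_subgraph_def finite_graph_def)
  moreover have "graph_iso G (map_graph h G)"
    using assms(2) inj by (auto simp: finite_graph_def intro: graph_iso_map_graph)
  ultimately show ?thesis using that by blast
qed

text \<open>Transitivity along the list; simplicity of the members supplies reflexivity for
  \<open>i = j\<close>. The bound \<open>N\<close> covers finite and infinite lists at once.\<close>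

lemma chain_sub:
  assumes simple: "\<And>i. enat i < N \<Longrightarrow> simple_graph (g i)"
    and step: "\<And>i. enat (Suc i) < N \<Longrightarrow> g i \<sqsubseteq> g (Suc i)"
    and "i \<le> j" "enat j < N"
  shows "g i \<sqsubseteq> g j"
  using assms(3,4)
proof (induction j rule: dec_induct)
  case base
  then show ?case by (simp add: simple sub_refl)
next
  case (step j)
  then have "enat j < N" by (meson enat_ord_simps(2) lessI less_trans)
  with step assms(2) show ?case by (blast intro: sub_trans)
qed

section \<open>Generating sets and composition\<close>

lemma generating_set_hereditary: "generating_set P \<G> \<Longrightarrow> hereditary P"
  unfolding generating_set_def hereditary_def by (blast intro: sub_trans)

text \<open>Heredity already keeps all subgraphs of members of \<open>\<G>\<close> inside
  \<open>P\<close>, so only the covering of \<open>P\<close> remains to be checked.\<close>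

lemma generating_setI:
  assumes "hereditary P" "\<G> \<subseteq> P" "\<And>G. G \<in> P \<Longrightarrow> \<exists>H\<in>\<G>. G \<sqsubseteq> H"
  shows "generating_set P \<G>"
  using assms unfolding generating_set_def hereditary_def by blast

lemma generating_setD: "generating_set P \<G> \<Longrightarrow> G \<in> P \<Longrightarrow> \<exists>H\<in>\<G>. G \<sqsubseteq> H"
  unfolding generating_set_def by blast

lemma hereditary_compositiveD:
  "hereditary_compositive P \<Longrightarrow> G \<in> P \<Longrightarrow> H \<in> P \<Longrightarrow> \<exists>K\<in>P. G \<sqsubseteq> K \<and> H \<sqsubseteq> K"
  by (simp add: hereditary_compositive_def)

lemma hereditaryD: "hereditary P \<Longrightarrow> G \<in> P \<Longrightarrow> H \<sqsubseteq> G \<Longrightarrow> H \<in> P"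
  by (auto simp: hereditary_def)

text \<open>Forwards, \<open>G\<close> and \<open>L\<close> have a common upper bound in
  \<open>P\<close>; a member of \<open>\<G>\<close> containing this bound contains \<open>L\<close>,
  hence survives in \<open>members_above \<G> L\<close>, and contains \<open>G\<close>. Backwards,
  if the members above \<open>H\<close> still generate \<open>P\<close>, one of them contains
  \<open>G\<close>, and it is a common upper bound of \<open>G\<close> and \<open>H\<close>.\<close>

lemma hereditary_compositive_iff_members_above:
  assumes P: "graph_property P"
  shows "hereditary_compositive P \<longleftrightarrow> (\<exists>\<G>. generating_set P \<G>) \<and>
    (\<forall>L\<in>P. \<forall>\<G>. generating_set P \<G> \<longrightarrow> generating_set P (members_above \<G> L))"
    (is "_ \<longleftrightarrow> ?B")
proof
  assume A: "hereditary_compositive P"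
  then have her: "hereditary P" by (simp add: hereditary_compositive_def)
  have "generating_set P P"
    using P by (intro generating_setI her)
      (auto simp: graph_property_def finite_graph_def intro!: bexI sub_refl)
  moreover have "generating_set P (members_above \<G> L)"
    if L: "L \<in> P" and \<G>: "generating_set P \<G>" for L \<G>
  proof (rule generating_setI[OF her])
    show "members_above \<G> L \<subseteq> P"
      using \<G> by (auto simp: members_above_def generating_set_def)
    fix G assume "G \<in> P"
    then obtain K where K: "K \<in> P" "G \<sqsubseteq> K" "L \<sqsubseteq> K"
      using hereditary_compositiveD[OF A _ L] by blast
    then obtain H where "H \<in> \<G>" "K \<sqsubseteq> H" using generating_setD[OF \<G>] by blast
    with K show "\<exists>H\<in>members_above \<G> L. G \<sqsubseteq> H"
      unfolding members_above_def by (blast intro: sub_trans)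
  qed
  ultimately show ?B by blast
next
  assume B: ?B
  then obtain \<G> where \<G>: "generating_set P \<G>" by blast
  have "\<exists>K\<in>P. G \<sqsubseteq> K \<and> H \<sqsubseteq> K" if "G \<in> P" "H \<in> P" for G H
  proof -
    have "generating_set P (members_above \<G> H)" using B \<G> that by blast
    from generating_setD[OF this \<open>G \<in> P\<close>] this show ?thesis
      by (auto simp: generating_set_def members_above_def)
  qed
  with generating_set_hereditary[OF \<G>] show "hereditary_compositive P"
    by (simp add: hereditary_compositive_def)
qed

text \<open>Two graphs of \<open>P\<close> lie below two members of the list, and the later member
  contains both. Its index is one of the two given indices, so it stays in range when the list is
  finite.\<close>

lemma ordered_generating_set_imp_hereditary_compositive:
  assumes P: "graph_property P" and gen: "generating_set P \<G>" and list: "listed_by (\<sqsubseteq>) \<G>"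
  shows "hereditary_compositive P"
proof -
  obtain N g where \<G>: "\<G> = g ` {i. enat i < N}"
    and step: "\<And>i. enat (Suc i) < N \<Longrightarrow> g i \<sqsubseteq> g (Suc i)"
    using list unfolding listed_by_def by blast
  have simple: "simple_graph (g i)" if "enat i < N" for i
    using that \<G> gen P by (auto simp: generating_set_def graph_property_def finite_graph_def)
  have "\<exists>K\<in>P. G \<sqsubseteq> K \<and> H \<sqsubseteq> K" if G: "G \<in> P" and H: "H \<in> P" for G H
  proof -
    obtain i j where ij: "enat i < N" "G \<sqsubseteq> g i" "enat j < N" "H \<sqsubseteq> g j"
      using generating_setD[OF gen G] generating_setD[OF gen H] \<G> by blast
    then have m: "enat (max i j) < N" by (simp add: max_def)
    have "g i \<sqsubseteq> g (max i j)" "g j \<sqsubseteq> g (max i j)"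
      using chain_sub[of N g, OF simple step _ m] by simp_all
    moreover have "g (max i j) \<in> P" using m \<G> gen by (auto simp: generating_set_def)
    ultimately show ?thesis using ij by (blast intro: sub_trans)
  qed
  with generating_set_hereditary[OF gen] show ?thesis by (simp add: hereditary_compositive_def)
qed

lemma listed_by_mono:
  assumes "listed_by R S" "\<And>x y. R x y \<Longrightarrow> R' x y"
  shows "listed_by R' S"
proof -
  obtain N g where "S = g ` {i. enat i < N}" "\<And>i. enat (Suc i) < N \<Longrightarrow> R (g i) (g (Suc i))"
    using assms(1) unfolding listed_by_def by blast
  with assms(2) show ?thesis
    unfolding listed_by_def by (intro exI[of _ N] exI[of _ g]) simp
qed

lemma listed_by_range:
  assumes "\<And>n. R (g n) (g (Suc n))"
  shows "listed_by R (range g)"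
  unfolding listed_by_def
  by (rule exI[of _ \<infinity>], rule exI[of _ g]) (simp add: assms)

section \<open>Enumeration of the property and exhausting chains\<close>

lemma graph_property_finite: "graph_property P \<Longrightarrow> G \<in> P \<Longrightarrow> finite_graph G"
  by (simp add: graph_property_def)

lemma graph_property_enumeration:
  assumes "graph_property P"
  obtains p :: "nat \<Rightarrow> nat sgraph" where "range p = P"
proof -
  have "countable P"
    by (rule countable_subset[OF _ countable_finite_graphs])
      (use assms in \<open>auto simp: graph_property_def\<close>)
  moreover have "P \<noteq> {}" using assms by (simp add: graph_property_def)
  ultimately show ?thesis using that[OF range_from_nat_into] by blast
qed

text \<open>Step \<open>n\<close> composes the current graph with the \<open>n\<close>-th graph of
  an enumeration of \<open>P\<close>, so every graph of \<open>P\<close> is absorbed eventually. The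
  result is relabelled to contain the current graph literally, which makes the union of the chain
  available as a graph.\<close>

lemma exhausting_subgraph_chain:
  assumes P: "graph_property P" and A: "hereditary_compositive P"
  obtains g where "\<And>n. g n \<in> P" "\<And>n. is_subgraph (g n) (g (Suc n))" "\<And>G. G \<in> P \<Longrightarrow> \<exists>n. G \<sqsubseteq> g n"
proof -
  obtain p :: "nat \<Rightarrow> nat sgraph" where p: "range p = P"
    using graph_property_enumeration[OF P] .
  have "\<exists>y. y \<in> P \<and> (is_subgraph x y \<and> p n \<sqsubseteq> y)" if x: "x \<in> P" for x n
  proof -
    have "p n \<in> P" using p by auto
    then obtain K where K: "K \<in> P" "x \<sqsubseteq> K" "p n \<sqsubseteq> K"
      using hereditary_compositiveD[OF A x] by blast
    obtain K' where K': "graph_iso K K'" "is_subgraph x K'"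
      using graph_iso_extending_subgraph[OF K(2) graph_property_finite[OF P K(1)]] .
    \<comment> \<open>The relabelled graph is still in \<open>P\<close> because properties are
      closed under isomorphism.\<close>
    then show ?thesis
      using P K unfolding graph_property_def by (blast intro: sub_trans graph_iso_imp_sub)
  qed
  moreover have "\<exists>x. x \<in> P" using p by blast
  ultimately obtain g where g: "\<And>n. g n \<in> P" "\<And>n. is_subgraph (g n) (g (Suc n)) \<and> p n \<sqsubseteq> g (Suc n)"
    using dependent_nat_choice[of "\<lambda>_ x. x \<in> P" "\<lambda>n x y. is_subgraph x y \<and> p n \<sqsubseteq> y"] by metis
  show ?thesis
  proof (rule that)
    show "\<exists>n. G \<sqsubseteq> g n" if "G \<in> P" for G
      using that g(2) p by blast
  qed (use g in auto)
qed

section \<open>Maximal graphs and chains of induced subgraphs\<close>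

lemma saturate:
  assumes P: "graph_property P" and G: "G \<in> P"
  obtains K where "maximal_in P K" "G \<sqsubseteq> K" "verts K = verts G"
proof -
  \<comment> \<open>Edges are added on a fixed finite vertex set, so the number of edges is bounded
    and a candidate with the most edges exists. One more edge would give a candidate with a larger
    count, hence the chosen graph is maximal.\<close>
  let ?Q = "\<lambda>K. K \<in> P \<and> verts K = verts G \<and> edges G \<subseteq> edges K"
  have finG: "finite (verts G)" using graph_property_finite[OF P G] by (simp add: finite_graph_def)
  have "card (edges K) < Suc (card (Pow (verts G)))" if "?Q K" for K
  proof -
    have "edges K \<subseteq> Pow (verts G)"
      using that graph_property_finite[OF P, of K]
      by (auto simp: finite_graph_def dest: simple_graph_edge_subset)
    then show ?thesis using finG card_mono[of "Pow (verts G)" "edges K"] by simp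
  qed
  then obtain K where K: "?Q K" and max: "\<And>K'. ?Q K' \<Longrightarrow> card (edges K') \<le> card (edges K)"
    using ex_has_greatest_nat[of ?Q G "\<lambda>K. card (edges K)" "Suc (card (Pow (verts G)))"] G
    by (metis order_refl less_imp_le)
  have "add_edge K u v \<notin> P" if "{u, v} \<notin> edges K" for u v
  proof
    assume "add_edge K u v \<in> P"
    with K have "?Q (add_edge K u v)" by (auto simp: add_edge_def)
    from max[OF this] show False
      using that finite_edges[OF graph_property_finite[OF P]] K by (simp add: add_edge_def)
  qed
  then have "maximal_in P K" using K by (simp add: maximal_in_def)
  moreover have "G \<sqsubseteq> K"
    using K graph_property_finite[OF P G] by (intro is_subgraph_imp_sub)
      (simp add: is_subgraph_def finite_graph_def)
  ultimately show ?thesis using that K by blast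
qed

text \<open>Were a non-edge of \<open>M\<close> sent to an edge of \<open>K\<close>, then
  \<open>M\<close> with this edge added would embed in \<open>K\<close> and lie in \<open>P\<close>
  by heredity, against maximality. So the embedding reflects edges and its image is induced; the
  comparison of orders makes it proper.\<close>

lemma maximal_sub_imp_proper_induced_sub:
  assumes P: "graph_property P" and her: "hereditary P" and M: "maximal_in P M"
    and K: "K \<in> P" and sub: "M \<sqsubseteq> K" and card: "card (verts M) < card (verts K)"
  shows "M \<sqsubset>\<^sub>i K"
proof -
  obtain f where f: "inj_on f (verts M)" "f ` verts M \<subseteq> verts K"
    "\<And>e. e \<in> edges M \<Longrightarrow> f ` e \<in> edges K"
    using subE[OF sub] by blast
  have simM: "simple_graph M" by (rule sub_imp_simple[OF sub])
  have simK: "simple_graph K" using graph_property_finite[OF P K] by (simp add: finite_graph_def)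
  have reflect: "{u, v} \<in> edges M" if uv: "u \<in> verts M" "v \<in> verts M" and e: "{f u, f v} \<in> edges K"
    for u v
  proof (rule ccontr)
    assume non: "{u, v} \<notin> edges M"
    \<comment> \<open>Since \<open>K\<close> has no loops, \<open>f u\<close> and \<open>f v\<close>
      differ, hence so do \<open>u\<close> and \<open>v\<close>, and the enlarged graph is
      simple.\<close>
    obtain a b where "a \<noteq> b" "{f u, f v} = {a, b}" using simple_graph_edgeE[OF simK e] by metis
    then have "u \<noteq> v" by (auto simp: doubleton_eq_iff)
    have "add_edge M u v \<sqsubseteq> K"
    proof (rule subI[where f = f])
      show "simple_graph (add_edge M u v)"
        using simM uv \<open>u \<noteq> v\<close> by (auto simp: simple_graph_def add_edge_def)
    qed (use f e in \<open>auto simp: add_edge_def\<close>)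
    then have "add_edge M u v \<in> P" by (rule hereditaryD[OF her K])
    with M uv non \<open>u \<noteq> v\<close> show False by (auto simp: maximal_in_def)
  qed
  have "induced K (f ` verts M) = map_graph f M"
  proof -
    have "{e \<in> edges K. e \<subseteq> f ` verts M} = (`) f ` edges M"
    proof (intro set_eqI iffI)
      fix e assume "e \<in> {e \<in> edges K. e \<subseteq> f ` verts M}"
      then have e: "e \<in> edges K" "e \<subseteq> f ` verts M" by auto
      obtain a b where ab: "e = {a, b}" using simple_graph_edgeE[OF simK e(1)] by metis
      with e obtain u v where uv: "u \<in> verts M" "v \<in> verts M" "e = {f u, f v}" by auto
      then have "{u, v} \<in> edges M" using reflect e by blast
      with uv show "e \<in> (`) f ` edges M" by (auto intro!: image_eqI[of _ _ "{u, v}"])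
    next
      fix e assume "e \<in> (`) f ` edges M"
      then show "e \<in> {e \<in> edges K. e \<subseteq> f ` verts M}"
        using f(3) simple_graph_edge_subset[OF simM] by auto
    qed
    then show ?thesis by (simp add: induced_def map_graph_def)
  qed
  then have "graph_iso M (induced K (f ` verts M))"
    using graph_iso_map_graph[OF simM f(1)] by simp
  moreover have "f ` verts M \<noteq> verts K"
    using card card_image[OF f(1)] by auto
  ultimately show ?thesis
    unfolding proper_induced_sub_def using f(2) by (intro exI[of _ "f ` verts M"]) auto
qed

text \<open>Take \<open>M\<close> in \<open>P\<close> with the most vertices and edges together.
  Composing \<open>M\<close> with any graph of \<open>P\<close> gives a graph that contains
  \<open>M\<close> and is no larger, hence is contained in \<open>M\<close>. So \<open>M\<close>
  alone generates \<open>P\<close>.\<close>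

lemma maximal_generating_set_bounded:
  assumes P: "graph_property P" and A: "hereditary_compositive P"
    and bound: "\<And>G. G \<in> P \<Longrightarrow> card (verts G) \<le> b"
  shows "\<exists>M. generating_set P {M} \<and> maximal_in P M"
proof -
  have her: "hereditary P" using A by (simp add: hereditary_compositive_def)
  let ?size = "\<lambda>G :: nat sgraph. card (verts G) + card (edges G)"
  \<comment> \<open>A crude bound, counting edges among all subsets of the vertex set, is enough for
    a greatest size to exist.\<close>
  have "?size G \<le> b + 2 ^ b" if G: "G \<in> P" for G
  proof -
    have fin: "finite_graph G" by (rule graph_property_finite[OF P G])
    then have "card (edges G) \<le> card (Pow (verts G))"
      by (intro card_mono) (auto simp: finite_graph_def dest: simple_graph_edge_subset)
    also have "\<dots> \<le> 2 ^ b"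
      using fin bound[OF G] by (simp add: finite_graph_def card_Pow)
    finally show ?thesis using bound[OF G] by simp
  qed
  moreover obtain G0 where "G0 \<in> P" using P by (auto simp: graph_property_def)
  ultimately obtain M where M: "M \<in> P" and max: "\<And>G. G \<in> P \<Longrightarrow> ?size G \<le> ?size M"
    using ex_has_greatest_nat[of "\<lambda>G. G \<in> P" G0 ?size "Suc (b + 2 ^ b)"]
    by (metis le_imp_less_Suc less_imp_le)
  have "G \<sqsubseteq> M" if G: "G \<in> P" for G
  proof -
    obtain K where K: "K \<in> P" "G \<sqsubseteq> K" "M \<sqsubseteq> K"
      using hereditary_compositiveD[OF A G M] by blast
    have "K \<sqsubseteq> M"
      by (rule sub_antisym_size[OF K(3) graph_property_finite[OF P K(1)] max[OF K(1)]])
    with K(2) show ?thesis by (rule sub_trans)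
  qed
  then have "generating_set P {M}" using M by (intro generating_setI her) auto
  \<comment> \<open>Adding an edge would exceed the greatest size, so \<open>M\<close> is maximal
    without further saturation.\<close>
  moreover have "add_edge M u v \<notin> P" if "{u, v} \<notin> edges M" for u v
    using max[of "add_edge M u v"] that finite_edges[OF graph_property_finite[OF P M]]
    by (auto simp: add_edge_def)
  then have "maximal_in P M" using M by (simp add: maximal_in_def)
  ultimately show ?thesis by blast
qed

text \<open>Each step composes the current graph with the next graph of an enumeration and with one
  of larger order, then saturates. The enumeration makes the chain generate \<open>P\<close>, the
  larger order makes each inclusion proper, and maximality of the current graph makes it
  induced.\<close>

lemma maximal_generating_set_unbounded:
  assumes P: "graph_property P" and A: "hereditary_compositive P"
    and unbounded: "\<And>b. \<exists>G\<in>P. b < card (verts G)"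
  shows "\<exists>g. generating_set P (range g) \<and> (\<forall>n. g n \<sqsubset>\<^sub>i g (Suc n)) \<and> (\<forall>n. maximal_in P (g n))"
proof -
  have her: "hereditary P" using A by (simp add: hereditary_compositive_def)
  have comp: "\<exists>K\<in>P. G \<sqsubseteq> K \<and> H \<sqsubseteq> K" if "G \<in> P" "H \<in> P" for G H
    using hereditary_compositiveD[OF A that] .
  obtain p :: "nat \<Rightarrow> nat sgraph" where p: "range p = P"
    using graph_property_enumeration[OF P] .
  have "\<exists>y. maximal_in P y \<and> (x \<sqsubset>\<^sub>i y \<and> p n \<sqsubseteq> y)" if x: "maximal_in P x" for x n
  proof -
    have "x \<in> P" using x by (simp add: maximal_in_def)
    obtain Y where Y: "Y \<in> P" "card (verts x) < card (verts Y)" using unbounded by blast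
    obtain Z where Z: "Z \<in> P" "p n \<sqsubseteq> Z" "Y \<sqsubseteq> Z" using comp[of "p n" Y] p Y by blast
    obtain K where K: "K \<in> P" "x \<sqsubseteq> K" "Z \<sqsubseteq> K" using comp \<open>x \<in> P\<close> Z by blast
    obtain M where M: "maximal_in P M" "K \<sqsubseteq> M" using saturate[OF P K(1)] .
    then have "M \<in> P" by (simp add: maximal_in_def)
    have sub: "x \<sqsubseteq> M" "Y \<sqsubseteq> M" "p n \<sqsubseteq> M" using Z K M by (blast intro: sub_trans)+
    have "card (verts x) < card (verts M)"
      using Y(2) sub_card_verts_le[OF sub(2) graph_property_finite[OF P \<open>M \<in> P\<close>]] by simp
    then have "x \<sqsubset>\<^sub>i M"
      using maximal_sub_imp_proper_induced_sub[OF P her x \<open>M \<in> P\<close> sub(1)] by simp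
    with M sub show ?thesis by blast
  qed
  moreover have "\<exists>x. maximal_in P x" using p saturate[OF P, of "p 0"] by blast
  ultimately obtain g where g: "\<And>n. maximal_in P (g n)" "\<And>n. g n \<sqsubset>\<^sub>i g (Suc n) \<and> p n \<sqsubseteq> g (Suc n)"
    using dependent_nat_choice[of "\<lambda>_. maximal_in P" "\<lambda>n x y. x \<sqsubset>\<^sub>i y \<and> p n \<sqsubseteq> y"] by metis
  have "generating_set P (range g)"
  proof (rule generating_setI[OF her])
    show "range g \<subseteq> P" using g(1) by (auto simp: maximal_in_def)
    show "\<exists>H\<in>range g. G \<sqsubseteq> H" if "G \<in> P" for G
      using that g(2) p by blast
  qed
  with g show ?thesis by blast
qed

section \<open>Equivalence with the two kinds of ordered generating sets\<close>

lemma hereditary_compositive_iff_ordered_generating_set: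
  assumes P: "graph_property P"
  shows "hereditary_compositive P \<longleftrightarrow> (\<exists>\<G>. generating_set P \<G> \<and> listed_by (\<sqsubseteq>) \<G>)"
proof
  assume A: "hereditary_compositive P"
  obtain g where g: "\<And>n. g n \<in> P" "\<And>n. is_subgraph (g n) (g (Suc n))" "\<And>G. G \<in> P \<Longrightarrow> \<exists>n. G \<sqsubseteq> g n"
    using exhausting_subgraph_chain[OF P A] by metis
  have "generating_set P (range g)"
    using A g by (intro generating_setI) (auto simp: hereditary_compositive_def)
  moreover have "listed_by (\<sqsubseteq>) (range g)"
    using g(2) by (intro listed_by_range is_subgraph_imp_sub)
  ultimately show "\<exists>\<G>. generating_set P \<G> \<and> listed_by (\<sqsubseteq>) \<G>" by blast
qed (use ordered_generating_set_imp_hereditary_compositive[OF P] in blast)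

lemma hereditary_compositive_iff_maximal_generating_set:
  assumes P: "graph_property P"
  shows "hereditary_compositive P \<longleftrightarrow>
    (\<exists>\<H>. generating_set P \<H> \<and> listed_by (\<sqsubset>\<^sub>i) \<H> \<and> (\<forall>H\<in>\<H>. maximal_in P H))"
    (is "_ \<longleftrightarrow> ?D")
proof
  assume A: "hereditary_compositive P"
  show ?D
  proof (cases "\<exists>b. \<forall>G\<in>P. card (verts G) \<le> b")
    case True
    then obtain M where M: "generating_set P {M}" "maximal_in P M"
      using maximal_generating_set_bounded[OF P A] by blast
    \<comment> \<open>A list of length 1 has no consecutive members, so the strict relation holds
      vacuously.\<close>
    have "listed_by (\<sqsubset>\<^sub>i) {M}"
      unfolding listed_by_def
      by (rule exI[of _ 1], rule exI[of _ "\<lambda>_. M"]) (auto simp: one_enat_def)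
    with M show ?thesis by blast
  next
    case False
    then have "\<exists>G\<in>P. b < card (verts G)" for b by (meson not_le)
    then obtain g where "generating_set P (range g)" "\<And>n. g n \<sqsubset>\<^sub>i g (Suc n)" "\<And>n. maximal_in P (g n)"
      using maximal_generating_set_unbounded[OF P A] by blast
    then show ?thesis by (intro exI[of _ "range g"]) (auto intro: listed_by_range)
  qed
next
  assume ?D
  then show "hereditary_compositive P"
    using ordered_generating_set_imp_hereditary_compositive[OF P]
      listed_by_mono[of "(\<sqsubset>\<^sub>i)" _ "(\<sqsubseteq>)"] proper_induced_sub_imp_sub by blast
qed

section \<open>Generating graphs\<close>

lemma finite_subset_incseq_Union:
  fixes A :: "nat \<Rightarrow> 'a set"
  assumes mono: "\<And>m n. m \<le> n \<Longrightarrow> A m \<subseteq> A n" and "finite S" "S \<subseteq> (\<Union>n. A n)"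
  shows "\<exists>n. S \<subseteq> A n"
  using assms(2,3)
proof (induction rule: finite_induct)
  case (insert x S)
  then obtain m n where "S \<subseteq> A m" "x \<in> A n" by auto
  then have "insert x S \<subseteq> A (max m n)"
    using mono[of m "max m n"] mono[of n "max m n"] by auto
  then show ?case by blast
qed simp

text \<open>The union \<open>U\<close> of a literal chain contains every member of the chain, hence
  every graph of \<open>P\<close>. Conversely a finite graph embedded in \<open>U\<close> uses
  finitely many vertices and edges, all present at some stage, so it lies in \<open>P\<close> by
  heredity.\<close>

lemma hereditary_compositive_imp_generating_graph:
  assumes P: "graph_property P" and A: "hereditary_compositive P"
  shows "\<exists>H :: 'v::infinite sgraph. generating_graph P H"
proof -
  obtain g where g: "\<And>n. g n \<in> P" "\<And>n. is_subgraph (g n) (g (Suc n))" "\<And>G. G \<in> P \<Longrightarrow> \<exists>n. G \<sqsubseteq> g n"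
    using exhausting_subgraph_chain[OF P A] by metis
  have her: "hereditary P" using A by (simp add: hereditary_compositive_def)
  define U where "U = SGraph (\<Union>n. verts (g n)) (\<Union>n. edges (g n))"
  have simple_g: "simple_graph (g n)" for n using g(2) by (simp add: is_subgraph_def)
  have mono: "verts (g m) \<subseteq> verts (g n)" "edges (g m) \<subseteq> edges (g n)" if "m \<le> n" for m n
    using g(2) lift_Suc_mono_le[of "\<lambda>n. verts (g n)", OF _ that]
      lift_Suc_mono_le[of "\<lambda>n. edges (g n)", OF _ that]
    by (simp_all add: is_subgraph_def)
  have U: "simple_graph U"
    using simple_g by (fastforce simp: simple_graph_def U_def)
  have U_iff: "G \<in> P \<longleftrightarrow> finite_graph G \<and> G \<sqsubseteq> U" for G
  proof
    assume "G \<in> P"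
    moreover then obtain n where "G \<sqsubseteq> g n" using g(3) by blast
    moreover have "g n \<sqsubseteq> U"
      using simple_g by (intro is_subgraph_imp_sub) (auto simp: is_subgraph_def U_def)
    ultimately show "finite_graph G \<and> G \<sqsubseteq> U"
      using P by (auto simp: graph_property_def intro: sub_trans)
  next
    assume G: "finite_graph G \<and> G \<sqsubseteq> U"
    then obtain f where f: "inj_on f (verts G)" "f ` verts G \<subseteq> verts U"
      "\<And>e. e \<in> edges G \<Longrightarrow> f ` e \<in> edges U"
      using subE by blast
    obtain m where m: "f ` verts G \<subseteq> verts (g m)"
      using finite_subset_incseq_Union[of "\<lambda>n. verts (g n)" "f ` verts G", OF mono(1)] f(2) G
      by (auto simp: finite_graph_def U_def)
    have "(`) f ` edges G \<subseteq> (\<Union>n. edges (g n))" using f(3) by (auto simp: U_def)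
    then obtain n where n: "(`) f ` edges G \<subseteq> edges (g n)"
      using finite_subset_incseq_Union[of "\<lambda>n. edges (g n)" "(`) f ` edges G", OF mono(2)] G
      by (auto simp: finite_edges)
    \<comment> \<open>The vertices and the edges may be captured at different stages; the later
      stage has both.\<close>
    have "f ` verts G \<subseteq> verts (g (max m n))" "(`) f ` edges G \<subseteq> edges (g (max m n))"
      using m n mono(1)[of m "max m n"] mono(2)[of n "max m n"] by auto
    then have "G \<sqsubseteq> g (max m n)"
      using G f(1) by (intro subI[where f = f]) (auto simp: finite_graph_def)
    then show "G \<in> P" by (rule hereditaryD[OF her g(1)])
  qed
  \<comment> \<open>\<open>U\<close> lives on the naturals; an infinite type \<open>'v\<close> has
    room for a copy of it.\<close>
  obtain h :: "nat \<Rightarrow> 'v" where "inj h"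
    using infinite_countable_subset[OF infinite_UNIV] by blast
  then have iso: "graph_iso U (map_graph h U)"
    by (intro graph_iso_map_graph[OF U]) (auto intro: inj_on_subset)
  then have "simple_graph (map_graph h U)" by (simp add: graph_iso_def)
  moreover have "G \<sqsubseteq> U \<longleftrightarrow> G \<sqsubseteq> map_graph h U" for G :: "nat sgraph"
    using sub_trans[OF _ graph_iso_imp_sub[OF iso]]
      sub_trans[OF _ graph_iso_imp_sub[OF graph_iso_sym[OF iso]]] by blast
  ultimately have "generating_graph P (map_graph h U)"
    unfolding generating_graph_def using U_iff by auto
  then show ?thesis ..
qed

text \<open>Copies of two graphs inside \<open>H\<close> have a finite union, again a subgraph of
  \<open>H\<close>, which contains both. The copies may overlap.\<close>

lemma generating_graph_imp_hereditary_compositive: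
  assumes gen: "generating_graph P H"
  shows "hereditary_compositive P"
proof -
  have P_iff: "G \<in> P \<longleftrightarrow> finite_graph G \<and> G \<sqsubseteq> H" for G
    using gen by (simp add: generating_graph_def)
  have "hereditary P"
    unfolding hereditary_def by (auto simp: P_iff intro: sub_trans sub_finite)
  moreover have "\<exists>K\<in>P. G \<sqsubseteq> K \<and> L \<sqsubseteq> K" if GL: "G \<in> P" "L \<in> P" for G L
  proof -
    obtain G' L' where G': "is_subgraph G' H" "graph_iso G G'"
      and L': "is_subgraph L' H" "graph_iso L L'"
      using GL by (auto simp: P_iff sub_def)
    have fin: "finite_graph G'" "finite_graph L'"
      using GL sub_finite[OF graph_iso_imp_sub[OF graph_iso_sym[OF G'(2)]]]
        sub_finite[OF graph_iso_imp_sub[OF graph_iso_sym[OF L'(2)]]]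
      by (simp_all add: P_iff)
    define K where "K = SGraph (verts G' \<union> verts L') (edges G' \<union> edges L')"
    have K: "finite_graph K"
      using fin by (fastforce simp: K_def finite_graph_def simple_graph_def)
    \<comment> \<open>The union has the vertex type of \<open>H\<close>, while members of
      \<open>P\<close> live on the naturals; being finite, it can be relabelled.\<close>
    then obtain h :: "_ \<Rightarrow> nat" where "inj_on h (verts K)"
      using finite_imp_inj_to_nat_seg[of "verts K"] by (auto simp: finite_graph_def)
    then have iso: "graph_iso K (map_graph h K)"
      using K by (intro graph_iso_map_graph) (simp_all add: finite_graph_def)
    then have K_iso: "K \<sqsubseteq> map_graph h K" "map_graph h K \<sqsubseteq> K"
      by (auto intro: graph_iso_imp_sub graph_iso_sym)
    have "K \<sqsubseteq> H"
      using K G' L' by (intro is_subgraph_imp_sub) (auto simp: K_def is_subgraph_def finite_graph_def)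
    with K_iso(2) have "map_graph h K \<in> P"
      unfolding P_iff using K by (auto intro: sub_trans sub_finite)
    moreover have "G' \<sqsubseteq> K" "L' \<sqsubseteq> K"
      using fin by (auto intro!: is_subgraph_imp_sub simp: K_def is_subgraph_def finite_graph_def)
    then have "G \<sqsubseteq> map_graph h K" "L \<sqsubseteq> map_graph h K"
      using sub_trans[OF graph_iso_imp_sub[OF G'(2)] sub_trans[OF _ K_iso(1)]]
        sub_trans[OF graph_iso_imp_sub[OF L'(2)] sub_trans[OF _ K_iso(1)]] by simp_all
    ultimately show ?thesis by blast
  qed
  ultimately show ?thesis by (simp add: hereditary_compositive_def)
qed

theorem theorem5p1:
  fixes P :: "nat sgraph set"
  assumes "graph_property P"
  shows "(hereditary_compositive P \<longleftrightarrow>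
            (\<exists>\<G>. generating_set P \<G>) \<and>
            (\<forall>L\<in>P. \<forall>\<G>. generating_set P \<G> \<longrightarrow> generating_set P (members_above \<G> L)))
       \<and> (hereditary_compositive P \<longleftrightarrow>
            (\<exists>\<G>. generating_set P \<G> \<and> listed_by (\<sqsubseteq>) \<G>))
       \<and> (hereditary_compositive P \<longleftrightarrow>
            (\<exists>\<H>. generating_set P \<H> \<and> listed_by (\<sqsubset>\<^sub>i) \<H> \<and> (\<forall>H\<in>\<H>. maximal_in P H)))
       \<and> (hereditary_compositive P \<longleftrightarrow>
            (\<exists>H :: 'v::infinite sgraph. generating_graph P H))"
  using hereditary_compositive_iff_members_above[OF assms]
    hereditary_compositive_iff_ordered_generating_set[OF assms]
    hereditary_compositive_iff_maximal_generating_set[OF assms]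
    hereditary_compositive_imp_generating_graph[OF assms]
    generating_graph_imp_hereditary_compositive
  by blast

end
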